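(* Let $n\in\mathbb N\cup\{\infty\}$. The category $n\mathsf{Whit}$ of Whitney $n$-categories is complete.
   Context: Stratified spaces. A stratification of a smooth manifold $M$ is a decomposition $M=\bigcup_{i\in\mathcal S}S_i$ into disjoint subsets (strata) indexed by a poset $\mathcal S$ such that: (1) it is locally finite; (2) $S_i\cap\overline{S_j}\neq\emptyset$ iff $S_i\subset\overline{S_j}$, and this occurs precisely when $i\le j$; (3) each $S_i$ is a locally closed smooth connected submanifold. A Whitney stratified manifold is a manifold with a stratification satisfying Whitney condition B: if $x\in S_i\subset\overline{S_j}$, sequences $(x_k)$ in $S_i$ and $(y_k)$ in $S_j$ converge to $x$, the secant lines $\overline{x_ky_k}$ converge to a line $L\le T_xM$ and the tangent planes $T_{y_k}S_j$ converge to $P\le T_xM$, then $L\le P$. A Whitney stratified space is a closed union of strata in a Whitney stratified manifold. In what follows "stratified space" means the stable germ of a compact Whitney stratified subspace of some $\mathbb R^k$ (stabilising by the standard inclusions $\mathbb R^k\hookrightarrow\mathbb R^{k+1}\hookrightarrow\cdots$); the same letter denotes the germ and the underlying space. A smooth map of such is the stable germ (stabilising by products with $\mathbb R$) of a map which extends to a smooth map of the ambient spaces. A stratified space is cellular if every stratum is contractible. Maps. A smooth map $f\colon X\to Y$ is stratified if for every stratum $B$ of $Y$ the preimage $f^{-1}B$ is a union of strata of $X$ and for every stratum $A\subset f^{-1}B$ the restriction $f|_A\colon A\to B$ is a submersion. A subdivision of $X$ is a Whitney stratification of the underlying space of $X$, each of whose strata lies in a stratum of $X$, with the same stable germ. A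 smooth map is prestratified if it becomes stratified for some subdivision of its source. Two (pre)stratified maps $f,g\colon X\to Y$ are homotopic relative to strata of dimension $<n$ if there is a smooth map germ $h\colon X\times[0,1]\to Y$ from $f$ to $g$ with each $h(-,t)$ (pre)stratified and $h(x,t)=h(x,0)$ for all $t$ whenever $x$ lies in a stratum of dimension $<n$. Categories. For $n\in\mathbb N\cup\{\infty\}$, $\mathsf{Strat}_n$ (respectively $\mathsf{Prestrat}_n$) is the small category whose objects are compact cellular stratified spaces of dimension $\le n$ and whose morphisms are homotopy classes of stratified (respectively prestratified) maps relative to strata of dimension $<n$ (for $n=\infty$, simply the maps). A stratified map $f\colon Y\to X$ trivially covers a stratum $A\subset X$ if $f^{-1}A$ is a single stratum and $f|_{f^{-1}A}$ is a diffeomorphism onto $A$. $\mathsf{Strat}_n$ has the Grothendieck topology in which a sieve on $X$ is covering iff for each stratum of $X$ there is a map in the sieve trivially covering it. Whitney categories. A Whitney $n$-category is a presheaf of sets on $\mathsf{Prestrat}_n$ whose restriction to $\mathsf{Strat}_n$ is a sheaf. A functor of Whitney $n$-categories is a natural transformation of presheaves. $n\mathsf{Whit}$ is the resulting full subcategory of the category of presheaves on $\mathsf{Prestrat}_n$. *)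

theory Defs
  imports "HOL-Analysis.Analysis" "HOL-Analysis.Finite_Function_Topology" "HOL-Library.Extended_Nat" "HOL-Library.Equipollence"
begin

section \<open>Categories\<close>

record ('o, 'm) cat =
  Obj :: "'o set"
  Arr :: "'m set"
  Dom :: "'m \<Rightarrow> 'o"
  Cod :: "'m \<Rightarrow> 'o"
  Ident :: "'o \<Rightarrow> 'm"
  Compose :: "'m \<Rightarrow> 'm \<Rightarrow> 'm"  \<comment> \<open>\<open>Compose C g f\<close> is "g after f"\<close>

locale category =
  fixes C :: "('o, 'm) cat"
  assumes Dom_Obj: "f \<in> Arr C \<Longrightarrow> Dom C f \<in> Obj C"
    and Cod_Obj: "f \<in> Arr C \<Longrightarrow> Cod C f \<in> Obj C"
    and Ident_Arr: "X \<in> Obj C \<Longrightarrow> Ident C X \<in> Arr C"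
    and Dom_Ident: "X \<in> Obj C \<Longrightarrow> Dom C (Ident C X) = X"
    and Cod_Ident: "X \<in> Obj C \<Longrightarrow> Cod C (Ident C X) = X"
    and Compose_Arr:
      "\<lbrakk>f \<in> Arr C; g \<in> Arr C; Cod C f = Dom C g\<rbrakk> \<Longrightarrow> Compose C g f \<in> Arr C"
    and Dom_Compose:
      "\<lbrakk>f \<in> Arr C; g \<in> Arr C; Cod C f = Dom C g\<rbrakk> \<Longrightarrow> Dom C (Compose C g f) = Dom C f"
    and Cod_Compose:
      "\<lbrakk>f \<in> Arr C; g \<in> Arr C; Cod C f = Dom C g\<rbrakk> \<Longrightarrow> Cod C (Compose C g f) = Cod C g"
    and Compose_Ident_right: "f \<in> Arr C \<Longrightarrow> Compose C f (Ident C (Dom C f)) = f"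
    and Compose_Ident_left: "f \<in> Arr C \<Longrightarrow> Compose C (Ident C (Cod C f)) f = f"
    and Compose_assoc:
      "\<lbrakk>f \<in> Arr C; g \<in> Arr C; h \<in> Arr C; Cod C f = Dom C g; Cod C g = Dom C h\<rbrakk>
        \<Longrightarrow> Compose C h (Compose C g f) = Compose C (Compose C h g) f"

definition op_cat :: "('o, 'm) cat \<Rightarrow> ('o, 'm) cat" where
  "op_cat C = \<lparr>Obj = Obj C, Arr = Arr C, Dom = Cod C, Cod = Dom C, Ident = Ident C,
               Compose = (\<lambda>g f. Compose C f g)\<rparr>"

definition full_subcat :: "('o, 'm) cat \<Rightarrow> ('o \<Rightarrow> bool) \<Rightarrow> ('o, 'm) cat" where
  "full_subcat C P = C\<lparr>Obj := {X \<in> Obj C. P X},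
                       Arr := {f \<in> Arr C. P (Dom C f) \<and> P (Cod C f)}\<rparr>"

record ('o, 'm, 'p, 'q) func =
  OMap :: "'o \<Rightarrow> 'p"
  AMap :: "'m \<Rightarrow> 'q"

definition is_functor ::
    "('o, 'm) cat \<Rightarrow> ('p, 'q) cat \<Rightarrow> ('o, 'm, 'p, 'q) func \<Rightarrow> bool" where
  "is_functor C D F \<longleftrightarrow>
     (\<forall>X\<in>Obj C. OMap F X \<in> Obj D) \<and>
     (\<forall>f\<in>Arr C. AMap F f \<in> Arr D \<and>
        Dom D (AMap F f) = OMap F (Dom C f) \<and> Cod D (AMap F f) = OMap F (Cod C f)) \<and>
     (\<forall>X\<in>Obj C. AMap F (Ident C X) = Ident D (OMap F X)) \<and>
     (\<forall>f\<in>Arr C. \<forall>g\<in>Arr C. Cod C f = Dom C g \<longrightarrow>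
        AMap F (Compose C g f) = Compose D (AMap F g) (AMap F f))"

definition comp_func ::
    "('p, 'q, 'r, 's) func \<Rightarrow> ('o, 'm, 'p, 'q) func \<Rightarrow> ('o, 'm, 'r, 's) func" where
  "comp_func G F = \<lparr>OMap = OMap G \<circ> OMap F, AMap = AMap G \<circ> AMap F\<rparr>"

text \<open>Components are extensional, so that equal natural transformations are equal terms.\<close>

definition is_nat_trans ::
    "('o, 'm) cat \<Rightarrow> ('p, 'q) cat \<Rightarrow> ('o, 'm, 'p, 'q) func \<Rightarrow> ('o \<Rightarrow> 'q)
      \<Rightarrow> ('o, 'm, 'p, 'q) func \<Rightarrow> bool" where
  "is_nat_trans C D F \<eta> G \<longleftrightarrow>
     \<eta> \<in> extensional (Obj C) \<and>
     (\<forall>X\<in>Obj C. \<eta> X \<in> Arr D \<and> Dom D (\<eta> X) = OMap F X \<and> Cod D (\<eta> X) = OMap G X) \<and>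
     (\<forall>f\<in>Arr C. Compose D (\<eta> (Cod C f)) (AMap F f) = Compose D (AMap G f) (\<eta> (Dom C f)))"

definition functor_cat ::
    "('o, 'm) cat \<Rightarrow> ('p, 'q) cat \<Rightarrow>
      (('o, 'm, 'p, 'q) func,
       ('o, 'm, 'p, 'q) func \<times> ('o \<Rightarrow> 'q) \<times> ('o, 'm, 'p, 'q) func) cat" where
  "functor_cat C D =
     \<lparr>Obj = {F. is_functor C D F},
      Arr = {(F, \<eta>, G). is_functor C D F \<and> is_functor C D G \<and> is_nat_trans C D F \<eta> G},
      Dom = (\<lambda>(F, \<eta>, G). F),
      Cod = (\<lambda>(F, \<eta>, G). G),
      Ident = (\<lambda>F. (F, (\<lambda>X\<in>Obj C. Ident D (OMap F X)), F)),
      Compose = (\<lambda>(G, \<theta>, H) (F, \<eta>, G'). (F, (\<lambda>X\<in>Obj C. Compose D (\<theta> X) (\<eta> X)), H))\<rparr>"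


subsection \<open>Small sets, limits and completeness\<close>

text \<open>
  "Set" and "small" are relative to a universe.  A type \<open>'u\<close> whose cardinality \<open>\<kappa>\<close> is a regular
  strong limit plays this role: the small sets are those of cardinality less than \<open>\<kappa>\<close>, and up to
  bijection they are subsets of \<open>'u\<close>.  For uncountable \<open>\<kappa>\<close> this is the category of sets in a
  Grothendieck universe; uncountability itself is not demanded.
\<close>

definition small :: "'u itself \<Rightarrow> 'a set \<Rightarrow> bool" where
  "small _ A \<longleftrightarrow> A \<prec> (UNIV :: 'u set)"

definition universe :: "'u itself \<Rightarrow> bool" where
  "universe U \<longleftrightarrow>
     infinite (UNIV :: 'u set) \<and>
     (\<forall>A :: 'u set. small U A \<longrightarrow> small U (Pow A)) \<and>
     (\<forall>(I :: 'u set) (A :: 'u \<Rightarrow> 'u set).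
        small U I \<and> (\<forall>i\<in>I. small U (A i)) \<longrightarrow> small U (\<Union>i\<in>I. A i))"

type_synonym 'u fn = "'u set \<times> ('u \<Rightarrow> 'u) \<times> 'u set"

definition fn_app :: "'u fn \<Rightarrow> 'u \<Rightarrow> 'u" where
  "fn_app m x = fst (snd m) x"

definition set_cat :: "('u set, 'u fn) cat" where
  "set_cat =
     \<lparr>Obj = {A. small TYPE('u) A},
      Arr = {(A, f, B). small TYPE('u) A \<and> small TYPE('u) B \<and> f \<in> A \<rightarrow>\<^sub>E B},
      Dom = (\<lambda>(A, f, B). A),
      Cod = (\<lambda>(A, f, B). B),
      Ident = (\<lambda>A. (A, (\<lambda>x\<in>A. x), A)),
      Compose = (\<lambda>(B, g, D) (A, f, B'). (A, compose A g f, D))\<rparr>"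

type_synonym ('o, 'm, 'u) presheaf = "('o, 'm, 'u set, 'u fn) func"

definition is_presheaf :: "('o, 'm) cat \<Rightarrow> ('o, 'm, 'u) presheaf \<Rightarrow> bool" where
  "is_presheaf C F \<longleftrightarrow> is_functor (op_cat C) set_cat F"

definition presheaf_cat ::
    "('o, 'm) cat \<Rightarrow> (('o, 'm, 'u) presheaf,
       ('o, 'm, 'u) presheaf \<times> ('o \<Rightarrow> 'u fn) \<times> ('o, 'm, 'u) presheaf) cat" where
  "presheaf_cat C = functor_cat (op_cat C) set_cat"

definition is_cone ::
    "('j, 'k) cat \<Rightarrow> ('o, 'm) cat \<Rightarrow> ('j, 'k, 'o, 'm) func \<Rightarrow> 'o \<Rightarrow> ('j \<Rightarrow> 'm) \<Rightarrow> bool" where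
  "is_cone J C D X \<pi> \<longleftrightarrow>
     X \<in> Obj C \<and>
     (\<forall>j\<in>Obj J. \<pi> j \<in> Arr C \<and> Dom C (\<pi> j) = X \<and> Cod C (\<pi> j) = OMap D j) \<and>
     (\<forall>a\<in>Arr J. Compose C (AMap D a) (\<pi> (Dom J a)) = \<pi> (Cod J a))"

definition is_limit ::
    "('j, 'k) cat \<Rightarrow> ('o, 'm) cat \<Rightarrow> ('j, 'k, 'o, 'm) func \<Rightarrow> 'o \<Rightarrow> ('j \<Rightarrow> 'm) \<Rightarrow> bool" where
  "is_limit J C D X \<pi> \<longleftrightarrow>
     is_cone J C D X \<pi> \<and>
     (\<forall>Y \<rho>. is_cone J C D Y \<rho> \<longrightarrow>
        (\<exists>!u. u \<in> Arr C \<and> Dom C u = Y \<and> Cod C u = X \<and>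
              (\<forall>j\<in>Obj J. Compose C (\<pi> j) u = \<rho> j)))"

text \<open>Every small category is isomorphic to one whose objects and arrows are elements of \<open>'u\<close>.\<close>

definition complete_category :: "'u itself \<Rightarrow> ('o, 'm) cat \<Rightarrow> bool" where
  "complete_category U C \<longleftrightarrow>
     category C \<and>
     (\<forall>(J :: ('u, 'u) cat) D.
        category J \<and> small U (Obj J) \<and> small U (Arr J) \<and> is_functor J C D \<longrightarrow>
        (\<exists>X \<pi>. is_limit J C D X \<pi>))"


subsection \<open>Sheaves\<close>

definition is_sieve :: "('o, 'm) cat \<Rightarrow> 'o \<Rightarrow> 'm set \<Rightarrow> bool" where
  "is_sieve C X R \<longleftrightarrow>
     R \<subseteq> {f \<in> Arr C. Cod C f = X} \<and>
     (\<forall>f\<in>R. \<forall>g\<in>Arr C. Cod C g = Dom C f \<longrightarrow> Compose C f g \<in> R)"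

definition is_matching ::
    "('o, 'm) cat \<Rightarrow> ('o, 'm, 'u) presheaf \<Rightarrow> 'm set \<Rightarrow> ('m \<Rightarrow> 'u) \<Rightarrow> bool" where
  "is_matching C F R x \<longleftrightarrow>
     (\<forall>f\<in>R. x f \<in> OMap F (Dom C f)) \<and>
     (\<forall>f\<in>R. \<forall>g\<in>Arr C. Cod C g = Dom C f \<longrightarrow> fn_app (AMap F g) (x f) = x (Compose C f g))"

definition is_sheaf ::
    "('o, 'm) cat \<Rightarrow> ('o \<Rightarrow> 'm set \<Rightarrow> bool) \<Rightarrow> ('o, 'm, 'u) presheaf \<Rightarrow> bool" where
  "is_sheaf C covering F \<longleftrightarrow>
     is_presheaf C F \<and>
     (\<forall>X\<in>Obj C. \<forall>R. is_sieve C X R \<and> covering X R \<longrightarrow>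
        (\<forall>x. is_matching C F R x \<longrightarrow>
           (\<exists>!y. y \<in> OMap F X \<and> (\<forall>f\<in>R. fn_app (AMap F f) y = x f))))"


section \<open>Smooth maps and submanifolds\<close>

text \<open>
  The union of the standard inclusions of the \<open>\<real>\<^sup>k\<close> is the space of finitely supported real
  sequences.  Its (\<open>\<ell>\<^sup>1\<close>) norm topology restricts to the usual topology on each \<open>\<real>\<^sup>k\<close>; a subset of
  some \<open>\<real>\<^sup>k\<close>, taken up to stabilisation, is just a subset of this space.
\<close>

type_synonym rinf = "nat \<Rightarrow>\<^sub>0 real"

definition coord_space :: "nat \<Rightarrow> rinf set" where
  "coord_space k = {x. Poly_Mapping.keys x \<subseteq> {..<k}}"

text \<open>
  \<open>U\<close> is to be open in the finite-dimensional linear subspace \<open>V\<close>.  Being \<open>C\<^sup>m\<^sup>+\<^sup>1\<close> means that all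
  directional derivatives in directions \<open>v \<in> V\<close> exist and are \<open>C\<^sup>m\<close>.
\<close>

fun Ck_on :: "nat \<Rightarrow> 'a::real_normed_vector set \<Rightarrow> 'a set \<Rightarrow> ('a \<Rightarrow> 'b::real_normed_vector) \<Rightarrow> bool"
where
  "Ck_on 0 V U f \<longleftrightarrow> continuous_on U f"
| "Ck_on (Suc m) V U f \<longleftrightarrow> continuous_on U f \<and>
     (\<forall>v\<in>V. \<exists>g. (\<forall>x\<in>U. ((\<lambda>t. f (x + t *\<^sub>R v)) has_vector_derivative g x) (at 0)) \<and> Ck_on m V U g)"

definition smooth_on ::
    "'a::real_normed_vector set \<Rightarrow> 'a set \<Rightarrow> ('a \<Rightarrow> 'b::real_normed_vector) \<Rightarrow> bool" where
  "smooth_on V U f \<longleftrightarrow> (\<forall>m. Ck_on m V U f)"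

text \<open>
  \<open>f\<close> is defined on \<open>A \<subseteq> V\<close> and is the restriction of a smooth map to \<open>W\<close> on a neighbourhood of
  \<open>A\<close> in \<open>V\<close>.
\<close>

definition extends_smoothly ::
    "'a::real_normed_vector set \<Rightarrow> 'b::real_normed_vector set \<Rightarrow> 'a set \<Rightarrow> ('a \<Rightarrow> 'b) \<Rightarrow> bool" where
  "extends_smoothly V W A f \<longleftrightarrow>
     (\<exists>U F. openin (top_of_set V) U \<and> A \<subseteq> U \<and> smooth_on V U F \<and> F ` U \<subseteq> W \<and> (\<forall>x\<in>A. F x = f x))"

text \<open>This does not depend on the choice of \<open>k\<close> and \<open>l\<close>, so it is a stable notion.\<close>

definition smooth_map :: "rinf set \<Rightarrow> rinf set \<Rightarrow> (rinf \<Rightarrow> rinf) \<Rightarrow> bool" where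
  "smooth_map A B f \<longleftrightarrow>
     f ` A \<subseteq> B \<and> (\<exists>k l. A \<subseteq> coord_space k \<and> B \<subseteq> coord_space l \<and> extends_smoothly (coord_space k) (coord_space l) A f)"

definition diffeomorphism :: "rinf set \<Rightarrow> rinf set \<Rightarrow> (rinf \<Rightarrow> rinf) \<Rightarrow> bool" where
  "diffeomorphism A B f \<longleftrightarrow>
     bij_betw f A B \<and> smooth_map A B f \<and> smooth_map B A (inv_into A f)"

definition submanifold :: "nat \<Rightarrow> nat \<Rightarrow> rinf set \<Rightarrow> bool" where
  "submanifold k d S \<longleftrightarrow>
     S \<subseteq> coord_space k \<and> d \<le> k \<and>
     (\<forall>p\<in>S. \<exists>U V \<phi> \<psi>.
        openin (top_of_set (coord_space k)) U \<and> p \<in> U \<and> openin (top_of_set (coord_space k)) V \<and>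
        homeomorphism U V \<phi> \<psi> \<and> smooth_on (coord_space k) U \<phi> \<and> smooth_on (coord_space k) V \<psi> \<and>
        \<phi> ` (S \<inter> U) = V \<inter> coord_space d)"

definition mdim :: "rinf set \<Rightarrow> nat" where
  "mdim S = (THE d. \<exists>k. submanifold k d S)"

definition curve_through :: "rinf set \<Rightarrow> rinf \<Rightarrow> (real \<Rightarrow> rinf) \<Rightarrow> bool" where
  "curve_through S p \<gamma> \<longleftrightarrow> smooth_on UNIV UNIV \<gamma> \<and> range \<gamma> \<subseteq> S \<and> \<gamma> 0 = p"

definition tangent_space :: "rinf set \<Rightarrow> rinf \<Rightarrow> rinf set" where
  "tangent_space S p = {v. \<exists>\<gamma>. curve_through S p \<gamma> \<and> (\<gamma> has_vector_derivative v) (at 0)}"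

text \<open>The image of the differential of the restriction of \<open>f\<close> to \<open>S\<close> at \<open>p\<close>.\<close>

definition differential_image :: "(rinf \<Rightarrow> rinf) \<Rightarrow> rinf set \<Rightarrow> rinf \<Rightarrow> rinf set" where
  "differential_image f S p =
     {w. \<exists>\<gamma>. curve_through S p \<gamma> \<and> ((f \<circ> \<gamma>) has_vector_derivative w) (at 0)}"

definition submersion :: "rinf set \<Rightarrow> rinf set \<Rightarrow> (rinf \<Rightarrow> rinf) \<Rightarrow> bool" where
  "submersion A B f \<longleftrightarrow>
     smooth_map A B f \<and> (\<forall>p\<in>A. differential_image f A p = tangent_space B (f p))"


section \<open>Whitney stratifications\<close>

text \<open>
  Convergence in the Grassmannian of \<open>d\<close>-dimensional subspaces, as a quotient of the space of
  \<open>d\<close>-frames.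
\<close>

definition is_frame :: "nat \<Rightarrow> (nat \<Rightarrow> rinf) \<Rightarrow> rinf set \<Rightarrow> bool" where
  "is_frame d e P \<longleftrightarrow> inj_on e {..<d} \<and> independent (e ` {..<d}) \<and> span (e ` {..<d}) = P"

definition planes_tendsto :: "nat \<Rightarrow> (nat \<Rightarrow> rinf set) \<Rightarrow> rinf set \<Rightarrow> bool" where
  "planes_tendsto d Ps P \<longleftrightarrow>
     (\<exists>es e. (\<forall>m. is_frame d (es m) (Ps m)) \<and> is_frame d e P \<and>
             (\<forall>a<d. (\<lambda>m. es m a) \<longlonglongrightarrow> e a))"

text \<open>Secant lines need \<open>xs m \<noteq> ys m\<close>, which is automatic for distinct strata.\<close>

definition whitney_B :: "rinf set \<Rightarrow> rinf set \<Rightarrow> bool" where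
  "whitney_B S T \<longleftrightarrow>
     (\<forall>x xs ys L P.
        x \<in> S \<and> range xs \<subseteq> S \<and> range ys \<subseteq> T \<and> (\<forall>m. xs m \<noteq> ys m) \<and>
        xs \<longlonglongrightarrow> x \<and> ys \<longlonglongrightarrow> x \<and>
        planes_tendsto 1 (\<lambda>m. span {ys m - xs m}) L \<and>
        planes_tendsto (mdim T) (\<lambda>m. tangent_space T (ys m)) P
        \<longrightarrow> L \<subseteq> P)"

text \<open>
  The poset of strata is encoded in the set of strata: \<open>S\<close> precedes \<open>T\<close> iff \<open>S \<subseteq> closure T\<close>,
  which is antisymmetric because distinct locally closed strata are disjoint.  The manifold is an
  open subset \<open>M\<close> of \<open>\<real>\<^sup>k\<close>, which suffices for germs of subspaces of \<open>\<real>\<^sup>k\<close>.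
\<close>

definition stratification :: "nat \<Rightarrow> rinf set \<Rightarrow> rinf set set \<Rightarrow> bool" where
  "stratification k M \<S> \<longleftrightarrow>
     openin (top_of_set (coord_space k)) M \<and>
     \<Union>\<S> = M \<and> disjoint \<S> \<and> {} \<notin> \<S> \<and>
     (\<forall>x\<in>M. \<exists>U. openin (top_of_set M) U \<and> x \<in> U \<and> finite {S \<in> \<S>. S \<inter> U \<noteq> {}}) \<and>
     (\<forall>S\<in>\<S>. \<forall>T\<in>\<S>. S \<inter> closure T \<noteq> {} \<longleftrightarrow> S \<subseteq> closure T) \<and>
     (\<forall>S\<in>\<S>. openin (top_of_set (closure S)) S \<and> (\<exists>d. submanifold k d S) \<and> connected S)"

definition whitney_stratification :: "nat \<Rightarrow> rinf set \<Rightarrow> rinf set set \<Rightarrow> bool" where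
  "whitney_stratification k M \<S> \<longleftrightarrow>
     stratification k M \<S> \<and> (\<forall>S\<in>\<S>. \<forall>T\<in>\<S>. S \<subseteq> closure T \<longrightarrow> whitney_B S T)"

text \<open>
  A stratified space is given by its set of strata \<open>\<X>\<close>, with underlying space \<open>\<Union>\<X>\<close>.  The ambient
  Euclidean space and its stratification off \<open>\<Union>\<X>\<close> only matter through their existence, since they
  are not retained by the stable germ.
\<close>

definition stratified_space :: "rinf set set \<Rightarrow> bool" where
  "stratified_space \<X> \<longleftrightarrow>
     compact (\<Union>\<X>) \<and> (\<exists>k M \<S>. whitney_stratification k M \<S> \<and> \<X> \<subseteq> \<S>)"

definition cellular :: "rinf set set \<Rightarrow> bool" where
  "cellular \<X> \<longleftrightarrow> (\<forall>S\<in>\<X>. contractible S)"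

definition dim_at_most :: "rinf set set \<Rightarrow> enat \<Rightarrow> bool" where
  "dim_at_most \<X> n \<longleftrightarrow> (\<forall>S\<in>\<X>. enat (mdim S) \<le> n)"

text \<open>
  Maps between stratified spaces are maps of the underlying spaces, taken to be \<open>undefined\<close>
  elsewhere.
\<close>

definition stratified_map :: "rinf set set \<Rightarrow> rinf set set \<Rightarrow> (rinf \<Rightarrow> rinf) \<Rightarrow> bool" where
  "stratified_map \<X> \<Y> f \<longleftrightarrow>
     f \<in> extensional (\<Union>\<X>) \<and> smooth_map (\<Union>\<X>) (\<Union>\<Y>) f \<and>
     (\<forall>B\<in>\<Y>. (\<exists>\<A>\<subseteq>\<X>. f -` B \<inter> \<Union>\<X> = \<Union>\<A>) \<and>
             (\<forall>A\<in>\<X>. A \<subseteq> f -` B \<longrightarrow> submersion A B f))"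

text \<open>As subsets of \<^typ>\<open>rinf\<close>, equal underlying spaces have equal stable germs.\<close>

definition subdivision :: "rinf set set \<Rightarrow> rinf set set \<Rightarrow> bool" where
  "subdivision \<X>' \<X> \<longleftrightarrow>
     stratified_space \<X>' \<and> \<Union>\<X>' = \<Union>\<X> \<and> (\<forall>S'\<in>\<X>'. \<exists>S\<in>\<X>. S' \<subseteq> S)"

definition prestratified_map :: "rinf set set \<Rightarrow> rinf set set \<Rightarrow> (rinf \<Rightarrow> rinf) \<Rightarrow> bool" where
  "prestratified_map \<X> \<Y> f \<longleftrightarrow> (\<exists>\<X>'. subdivision \<X>' \<X> \<and> stratified_map \<X>' \<Y> f)"


section \<open>The categories of stratified and prestratified maps\<close>

text \<open>
  In this section \<open>P\<close> is \<^const>\<open>stratified_map\<close> or \<^const>\<open>prestratified_map\<close>.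
\<close>

type_synonym map_class = "rinf set set \<Rightarrow> rinf set set \<Rightarrow> (rinf \<Rightarrow> rinf) \<Rightarrow> bool"

definition homotopy ::
    "map_class \<Rightarrow> enat \<Rightarrow> rinf set set \<Rightarrow> rinf set set \<Rightarrow> (rinf \<Rightarrow> rinf) \<Rightarrow> (rinf \<Rightarrow> rinf)
      \<Rightarrow> (rinf \<times> real \<Rightarrow> rinf) \<Rightarrow> bool" where
  "homotopy P n \<X> \<Y> f g h \<longleftrightarrow>
     (\<exists>k l. \<Union>\<X> \<subseteq> coord_space k \<and> \<Union>\<Y> \<subseteq> coord_space l \<and>
        extends_smoothly (coord_space k \<times> UNIV) (coord_space l) (\<Union>\<X> \<times> {0..1}) h) \<and>
     (\<forall>x\<in>\<Union>\<X>. h (x, 0) = f x \<and> h (x, 1) = g x) \<and>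
     (\<forall>t\<in>{0..1}. P \<X> \<Y> (\<lambda>x\<in>\<Union>\<X>. h (x, t))) \<and>
     (\<forall>S\<in>\<X>. enat (mdim S) < n \<longrightarrow> (\<forall>x\<in>S. \<forall>t\<in>{0..1}. h (x, t) = h (x, 0)))"

definition homotopic_maps ::
    "map_class \<Rightarrow> enat \<Rightarrow> rinf set set \<Rightarrow> rinf set set \<Rightarrow> (rinf \<Rightarrow> rinf) \<Rightarrow> (rinf \<Rightarrow> rinf) \<Rightarrow> bool"
where
  "homotopic_maps P n \<X> \<Y> f g \<longleftrightarrow> P \<X> \<Y> f \<and> P \<X> \<Y> g \<and> (\<exists>h. homotopy P n \<X> \<Y> f g h)"

text \<open>
  Homotopy classes are the classes of the equivalence relation generated by homotopy.  For
  \<open>n = \<infinity>\<close> homotopies are constant, and the class of \<open>f\<close> is \<open>{f}\<close>.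
\<close>

definition homotopy_class ::
    "map_class \<Rightarrow> enat \<Rightarrow> rinf set set \<Rightarrow> rinf set set \<Rightarrow> (rinf \<Rightarrow> rinf) \<Rightarrow> (rinf \<Rightarrow> rinf) set" where
  "homotopy_class P n \<X> \<Y> f = {g. equivclp (homotopic_maps P n \<X> \<Y>) f g}"

type_synonym map_arrow = "rinf set set \<times> (rinf \<Rightarrow> rinf) set \<times> rinf set set"

text \<open>
  The composite of two classes is the class of the composites \<open>g \<circ> f\<close> of their members, written
  as a union so as not to choose representatives.
\<close>

definition map_cat :: "map_class \<Rightarrow> enat \<Rightarrow> (rinf set set, map_arrow) cat" where
  "map_cat P n =
     (let Ob = {\<X>. stratified_space \<X> \<and> cellular \<X> \<and> dim_at_most \<X> n} in
     \<lparr>Obj = Ob,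
      Arr = {(\<X>, homotopy_class P n \<X> \<Y> f, \<Y>) | \<X> \<Y> f. \<X> \<in> Ob \<and> \<Y> \<in> Ob \<and> P \<X> \<Y> f},
      Dom = (\<lambda>(\<X>, \<C>, \<Y>). \<X>),
      Cod = (\<lambda>(\<X>, \<C>, \<Y>). \<Y>),
      Ident = (\<lambda>\<X>. (\<X>, homotopy_class P n \<X> \<X> (\<lambda>x\<in>\<Union>\<X>. x), \<X>)),
      Compose = (\<lambda>(\<Y>, \<D>, \<Z>) (\<X>, \<C>, \<Y>').
        (\<X>, \<Union>f\<in>\<C>. \<Union>g\<in>\<D>. homotopy_class P n \<X> \<Z> (compose (\<Union>\<X>) g f), \<Z>))\<rparr>)"

definition Strat :: "enat \<Rightarrow> (rinf set set, map_arrow) cat" where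
  "Strat n = map_cat stratified_map n"

definition Prestrat :: "enat \<Rightarrow> (rinf set set, map_arrow) cat" where
  "Prestrat n = map_cat prestratified_map n"

definition Strat_to_Prestrat ::
    "enat \<Rightarrow> (rinf set set, map_arrow, rinf set set, map_arrow) func" where
  "Strat_to_Prestrat n =
     \<lparr>OMap = (\<lambda>\<X>. \<X>),
      AMap = (\<lambda>(\<X>, \<C>, \<Y>). (\<X>, \<Union>f\<in>\<C>. homotopy_class prestratified_map n \<X> \<Y> f, \<Y>))\<rparr>"

definition trivially_covers :: "rinf set set \<Rightarrow> (rinf \<Rightarrow> rinf) \<Rightarrow> rinf set \<Rightarrow> bool" where
  "trivially_covers \<Y> f A \<longleftrightarrow>
     f -` A \<inter> \<Union>\<Y> \<in> \<Y> \<and> diffeomorphism (f -` A \<inter> \<Union>\<Y>) A f"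

definition strat_covering :: "rinf set set \<Rightarrow> map_arrow set \<Rightarrow> bool" where
  "strat_covering \<X> R \<longleftrightarrow> (\<forall>A\<in>\<X>. \<exists>(\<Y>, \<C>, \<Z>)\<in>R. \<exists>f\<in>\<C>. trivially_covers \<Y> f A)"


section \<open>Whitney categories\<close>

type_synonym 'u strat_presheaf = "(rinf set set, map_arrow, 'u) presheaf"

definition is_whitney_category :: "enat \<Rightarrow> 'u strat_presheaf \<Rightarrow> bool" where
  "is_whitney_category n F \<longleftrightarrow>
     is_presheaf (Prestrat n) F \<and>
     is_sheaf (Strat n) strat_covering (comp_func F (Strat_to_Prestrat n))"

definition Whit ::
    "enat \<Rightarrow> ('u strat_presheaf,
      'u strat_presheaf \<times> (rinf set set \<Rightarrow> 'u fn) \<times> 'u strat_presheaf) cat" where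
  "Whit n = full_subcat (presheaf_cat (Prestrat n)) (is_whitney_category n)"

end

theory Submission
  imports Defs
begin

text \<open>
  Limits of presheaves are computed pointwise, as sets of compatible families; these are small
  because the universe is closed under small products.  Sheaves are closed under pointwise limits:
  a matching family for the limit is a compatible family of matching families, each of which glues
  uniquely, and uniqueness makes the glued sections compatible.
\<close>

section \<open>Small sets\<close>

text \<open>The sheaf condition is tested over \<open>Strat n\<close>, whereas limits are formed
  over \<open>Prestrat n\<close>. The comparison \<open>Strat_to_Prestrat n\<close> is only shown to
  send arrows to arrows and to respect sources and targets, so presheaf laws cannot simply be pulled
  back along it. For this reason the results about the limit concern \<open>comp_func lim G\<close>
  for a variable \<open>G\<close>: the laws for identities and composites are inherited from the
  presheaves \<open>comp_func (OMap D j) G\<close>, for which they are part of the sheaf condition.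
  The choice \<open>G = id_func\<close> gives the presheaf on \<open>Prestrat n\<close>, the choice
  \<open>G = Strat_to_Prestrat n\<close> the sheaf condition. A limit among all presheaves is then a
  limit in \<open>Whit n\<close>, because this subcategory is full.\<close>

lemma small_lepoll: "small U B \<Longrightarrow> A \<lesssim> B \<Longrightarrow> small U A"
  unfolding small_def by (rule lesspoll_trans1)

lemma small_Pow:
  fixes A :: "'u set"
  assumes "universe TYPE('u)" "small TYPE('u) A"
  shows "small TYPE('u) (Pow A)"
  using assms unfolding universe_def by blast

lemma small_UN:
  fixes I :: "'u set" and A :: "'u \<Rightarrow> 'u set"
  assumes "universe TYPE('u)" "small TYPE('u) I" "\<And>i. i \<in> I \<Longrightarrow> small TYPE('u) (A i)"
  shows "small TYPE('u) (\<Union>i\<in>I. A i)"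
  using assms unfolding universe_def by blast

text \<open>A member of the product is recovered from its graph, a subset of the coded disjoint sum
  \<open>V\<close>. The product therefore embeds in \<open>Pow V\<close>, which is small because the
  universe is closed under small unions and power sets.\<close>

lemma small_PiE:
  fixes I :: "'u set" and A :: "'u \<Rightarrow> 'u set"
  assumes univ: "universe TYPE('u)" and I: "small TYPE('u) I"
    and A: "\<And>i. i \<in> I \<Longrightarrow> small TYPE('u) (A i)"
  shows "small TYPE('u) (PiE I A)"
proof -
  have "infinite (UNIV :: 'u set)"
    using univ by (simp add: universe_def)
  \<comment> \<open>The square of an infinite cardinal is that cardinal again; the resulting pairing
    allows disjoint sums to be formed inside \<open>'u\<close>.\<close>
  from ordIso_imp_ordLeq[OF card_of_Times_same_infinite[OF this]]
  obtain p :: "'u \<times> 'u \<Rightarrow> 'u" where p: "inj p"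
    unfolding card_of_ordLeq[symmetric] UNIV_Times_UNIV by blast
  define V where "V = (\<Union>i\<in>I. (\<lambda>x. p (i, x)) ` A i)"
  have "small TYPE('u) V"
    unfolding V_def by (intro small_UN univ I small_lepoll[OF A image_lepoll])
  moreover have "PiE I A \<lesssim> Pow V"
    unfolding lepoll_def
  proof (intro exI conjI)
    show "inj_on (\<lambda>s. (\<lambda>i. p (i, s i)) ` I) (PiE I A)"
    proof (rule inj_onI)
      fix s t assume st: "s \<in> PiE I A" "t \<in> PiE I A"
        and eq: "(\<lambda>i. p (i, s i)) ` I = (\<lambda>i. p (i, t i)) ` I"
      have "s i = t i" if "i \<in> I" for i
      proof -
        have "p (i, s i) \<in> (\<lambda>i. p (i, t i)) ` I"
          using that eq by blast
        then show ?thesis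
          using p by (auto dest: injD)
      qed
      then show "s = t"
        using st by (blast intro: PiE_ext)
    qed
    show "(\<lambda>s. (\<lambda>i. p (i, s i)) ` I) ` PiE I A \<subseteq> Pow V"
      unfolding V_def by fastforce
  qed
  ultimately show ?thesis
    using univ small_Pow small_lepoll by blast
qed


section \<open>The category of small sets\<close>

definition set_hom :: "'u set \<Rightarrow> 'u set \<Rightarrow> 'u fn set" where
  "set_hom A B = {m \<in> Arr set_cat. Dom set_cat m = A \<and> Cod set_cat m = B}"

lemma set_homI:
  fixes A B :: "'u set"
  assumes "small TYPE('u) A" "small TYPE('u) B" "\<And>x. x \<in> A \<Longrightarrow> f x \<in> B"
  shows "(A, \<lambda>x\<in>A. f x, B) \<in> set_hom A B"
  using assms by (auto simp: set_hom_def set_cat_def)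

lemma set_hom_app: "m \<in> set_hom A B \<Longrightarrow> x \<in> A \<Longrightarrow> fn_app m x \<in> B"
  by (auto simp: set_hom_def set_cat_def fn_app_def)

text \<open>The underlying function of an arrow is extensional, so values on the source determine
  the whole triple. Naturality and uniqueness claims are brought down to elements this way.\<close>

lemma set_hom_eqI:
  assumes "m \<in> set_hom A B" "m' \<in> set_hom A B" "\<And>x. x \<in> A \<Longrightarrow> fn_app m x = fn_app m' x"
  shows "m = m'"
proof -
  obtain f f' where "m = (A, f, B)" "m' = (A, f', B)" "f \<in> A \<rightarrow>\<^sub>E B" "f' \<in> A \<rightarrow>\<^sub>E B"
    using assms(1,2) by (auto simp: set_hom_def set_cat_def)
  then show ?thesis
    using assms(3) PiE_ext[of f A "\<lambda>_. B" f'] by (simp add: fn_app_def)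
qed

lemma fn_app_triple [simp]: "fn_app (A, f, B) = f"
  by (rule ext) (simp add: fn_app_def)

lemma set_hom_Compose:
  "m \<in> set_hom A B \<Longrightarrow> m' \<in> set_hom B E \<Longrightarrow> Compose set_cat m' m \<in> set_hom A E"
  by (auto simp: set_hom_def set_cat_def compose_def)

lemma fn_app_Compose:
  "m \<in> set_hom A B \<Longrightarrow> x \<in> A \<Longrightarrow> fn_app (Compose set_cat m' m) x = fn_app m' (fn_app m x)"
  by (cases m') (auto simp: set_hom_def set_cat_def fn_app_def compose_def)

lemma fn_app_Ident: "x \<in> A \<Longrightarrow> fn_app (Ident set_cat A) x = x"
  by (simp add: set_cat_def)

lemma Obj_set_cat: "A \<in> Obj (set_cat :: ('u set, 'u fn) cat) \<longleftrightarrow> small TYPE('u) A"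
  by (simp add: set_cat_def)

lemma category_set_cat: "category (set_cat :: ('u set, 'u fn) cat)"
proof
  fix f g h :: "'u fn"
  assume fgh: "f \<in> Arr set_cat" "g \<in> Arr set_cat" "h \<in> Arr set_cat"
    "Cod set_cat f = Dom set_cat g" "Cod set_cat g = Dom set_cat h"
  then have f: "f \<in> set_hom (Dom set_cat f) (Dom set_cat g)"
    and g: "g \<in> set_hom (Dom set_cat g) (Dom set_cat h)"
    and h: "h \<in> set_hom (Dom set_cat h) (Cod set_cat h)"
    by (auto simp: set_hom_def)
  show "Compose set_cat h (Compose set_cat g f) = Compose set_cat (Compose set_cat h g) f"
    by (rule set_hom_eqI[OF set_hom_Compose[OF set_hom_Compose[OF f g] h]
          set_hom_Compose[OF f set_hom_Compose[OF g h]]])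
      (simp add: fn_app_Compose[OF f] fn_app_Compose[OF g] set_hom_app[OF f]
        fn_app_Compose[OF set_hom_Compose[OF f g]])
qed (fastforce simp: set_cat_def compose_def restrict_def PiE_def extensional_def)+


section \<open>Functor categories and full subcategories\<close>

text \<open>The laws are checked componentwise in \<open>D\<close>. Naturality squares see only the
  arrows of \<open>C\<close> and their endpoints, so the assumption on \<open>C\<close> concerns
  endpoints alone and can be met by \<open>Prestrat n\<close>.\<close>

lemma category_functor_cat:
  assumes D: "category D"
    and C: "\<And>f. f \<in> Arr C \<Longrightarrow> Dom C f \<in> Obj C \<and> Cod C f \<in> Obj C"
  shows "category (functor_cat C D)"
proof -
  interpret D: category D by (rule D)
  show ?thesis
  proof
    fix F assume F: "F \<in> Obj (functor_cat C D)"
    then show "Ident (functor_cat C D) F \<in> Arr (functor_cat C D)"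
      using C unfolding functor_cat_def is_nat_trans_def is_functor_def
      by (auto simp: D.Ident_Arr D.Dom_Ident D.Cod_Ident)
        (metis D.Compose_Ident_left D.Compose_Ident_right)
  next
    fix s t assume st: "s \<in> Arr (functor_cat C D)" "t \<in> Arr (functor_cat C D)"
      "Cod (functor_cat C D) s = Dom (functor_cat C D) t"
    obtain F \<eta> G \<theta> H where s: "s = (F, \<eta>, G)" and t: "t = (G, \<theta>, H)"
      using st by (auto simp: functor_cat_def)
    have fun_FGH: "is_functor C D F" "is_functor C D G" "is_functor C D H"
      and \<eta>: "is_nat_trans C D F \<eta> G" and \<theta>: "is_nat_trans C D G \<theta> H"
      using st by (auto simp: functor_cat_def s t)
    have "is_nat_trans C D F (\<lambda>X\<in>Obj C. Compose D (\<theta> X) (\<eta> X)) H"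
      unfolding is_nat_trans_def
    proof (intro conjI ballI)
      fix f assume f: "f \<in> Arr C"
      let ?X = "Dom C f" and ?Y = "Cod C f"
      have X: "?X \<in> Obj C" and Y: "?Y \<in> Obj C" using C[OF f] by auto
      note comp = \<eta>[unfolded is_nat_trans_def] \<theta>[unfolded is_nat_trans_def]
        fun_FGH[unfolded is_functor_def]
      have "Compose D (Compose D (\<theta> ?Y) (\<eta> ?Y)) (AMap F f)
          = Compose D (\<theta> ?Y) (Compose D (\<eta> ?Y) (AMap F f))"
        using comp X Y f by (intro D.Compose_assoc[symmetric]) auto
      also have "\<dots> = Compose D (\<theta> ?Y) (Compose D (AMap G f) (\<eta> ?X))"
        using comp f by auto
      also have "\<dots> = Compose D (Compose D (\<theta> ?Y) (AMap G f)) (\<eta> ?X)"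
        using comp X Y f by (intro D.Compose_assoc) auto
      also have "\<dots> = Compose D (Compose D (AMap H f) (\<theta> ?X)) (\<eta> ?X)"
        using comp f by auto
      also have "\<dots> = Compose D (AMap H f) (Compose D (\<theta> ?X) (\<eta> ?X))"
        using comp X Y f by (intro D.Compose_assoc[symmetric]) auto
      finally show "Compose D ((\<lambda>X\<in>Obj C. Compose D (\<theta> X) (\<eta> X)) ?Y) (AMap F f)
          = Compose D (AMap H f) ((\<lambda>X\<in>Obj C. Compose D (\<theta> X) (\<eta> X)) ?X)"
        using X Y by simp
    qed (use \<eta> \<theta> in \<open>auto simp: is_nat_trans_def D.Compose_Arr D.Dom_Compose D.Cod_Compose\<close>)
    then show "Compose (functor_cat C D) t s \<in> Arr (functor_cat C D)"
      using fun_FGH by (simp add: s t functor_cat_def)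
  next
    fix s assume "s \<in> Arr (functor_cat C D)"
    then obtain F \<eta> G where s: "s = (F, \<eta>, G)" and \<eta>: "is_nat_trans C D F \<eta> G"
      by (auto simp: functor_cat_def)
    show "Compose (functor_cat C D) s (Ident (functor_cat C D) (Dom (functor_cat C D) s)) = s"
      "Compose (functor_cat C D) (Ident (functor_cat C D) (Cod (functor_cat C D) s)) s = s"
      using \<eta> unfolding s functor_cat_def is_nat_trans_def
      by (auto intro!: extensionalityI[of _ "Obj C"])
        (metis D.Compose_Ident_right D.Compose_Ident_left)+
  next
    fix s t r assume str: "s \<in> Arr (functor_cat C D)" "t \<in> Arr (functor_cat C D)"
      "r \<in> Arr (functor_cat C D)"
      "Cod (functor_cat C D) s = Dom (functor_cat C D) t"
      "Cod (functor_cat C D) t = Dom (functor_cat C D) r"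
    then show "Compose (functor_cat C D) r (Compose (functor_cat C D) t s)
        = Compose (functor_cat C D) (Compose (functor_cat C D) r t) s"
      by (auto simp: functor_cat_def is_nat_trans_def intro!: restrict_ext D.Compose_assoc)
  qed (auto simp: functor_cat_def)
qed

lemma category_full_subcat:
  assumes "category C"
  shows "category (full_subcat C P)"
proof -
  interpret category C by (rule assms)
  show ?thesis
    by unfold_locales
      (auto simp: full_subcat_def Dom_Obj Cod_Obj Ident_Arr Dom_Ident Cod_Ident Compose_Arr
        Dom_Compose Cod_Compose Compose_Ident_left Compose_Ident_right Compose_assoc)
qed

lemma is_functor_full_subcatD: "is_functor J (full_subcat C P) D \<Longrightarrow> is_functor J C D"
  by (auto simp: is_functor_def full_subcat_def)

text \<open>Cones in the full subcategory are the ambient cones with apex in \<open>P\<close>, since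
  the objects of the diagram already satisfy \<open>P\<close>; and fullness keeps every mediating
  arrow between objects satisfying \<open>P\<close>.\<close>

lemma is_limit_full_subcat:
  assumes lim: "is_limit J C D X \<pi>" and D: "is_functor J (full_subcat C P) D" and X: "P X"
  shows "is_limit J (full_subcat C P) D X \<pi>"
proof -
  have P: "P (OMap D j)" if "j \<in> Obj J" for j
    using D that by (auto simp: is_functor_def full_subcat_def)
  have cone: "is_cone J (full_subcat C P) D Y \<rho> \<longleftrightarrow> is_cone J C D Y \<rho> \<and> P Y" for Y \<rho>
    using P by (auto simp: is_cone_def full_subcat_def)
  show ?thesis
    unfolding is_limit_def cone
  proof (intro conjI allI impI)
    fix Y \<rho> assume "is_cone J C D Y \<rho> \<and> P Y"
    with lim X show "\<exists>!u. u \<in> Arr (full_subcat C P) \<and> Dom (full_subcat C P) u = Y \<and>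
        Cod (full_subcat C P) u = X \<and> (\<forall>j\<in>Obj J. Compose (full_subcat C P) (\<pi> j) u = \<rho> j)"
      unfolding is_limit_def full_subcat_def by (simp, metis)
  qed (use lim X in \<open>auto simp: is_limit_def\<close>)
qed


section \<open>Presheaves\<close>

lemma is_presheaf_iff:
  fixes F :: "('o, 'm, 'u) presheaf"
  shows "is_presheaf C F \<longleftrightarrow>
     (\<forall>X\<in>Obj C. small TYPE('u) (OMap F X)) \<and>
     (\<forall>f\<in>Arr C. AMap F f \<in> set_hom (OMap F (Cod C f)) (OMap F (Dom C f))) \<and>
     (\<forall>X\<in>Obj C. AMap F (Ident C X) = Ident set_cat (OMap F X)) \<and>
     (\<forall>f\<in>Arr C. \<forall>g\<in>Arr C. Cod C f = Dom C g \<longrightarrow>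
        AMap F (Compose C g f) = Compose set_cat (AMap F f) (AMap F g))"
  unfolding is_presheaf_def is_functor_def op_cat_def set_hom_def
  by (auto simp: Obj_set_cat)

lemma Obj_presheaf_cat: "F \<in> Obj (presheaf_cat C) \<longleftrightarrow> is_presheaf C F"
  by (simp add: presheaf_cat_def functor_cat_def is_presheaf_def)

lemma Arr_presheaf_cat:
  "(F, \<eta>, G) \<in> Arr (presheaf_cat C) \<longleftrightarrow> is_presheaf C F \<and> is_presheaf C G \<and>
     \<eta> \<in> extensional (Obj C) \<and> (\<forall>X\<in>Obj C. \<eta> X \<in> set_hom (OMap F X) (OMap G X)) \<and>
     (\<forall>f\<in>Arr C. Compose set_cat (\<eta> (Dom C f)) (AMap F f)
        = Compose set_cat (AMap G f) (\<eta> (Cod C f)))"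
  by (auto simp: presheaf_cat_def functor_cat_def is_presheaf_def is_nat_trans_def op_cat_def
      set_hom_def)

lemma presheaf_cat_simps [simp]:
  "Dom (presheaf_cat C) (F, \<eta>, G) = F"
  "Cod (presheaf_cat C) (F, \<eta>, G) = G"
  "Compose (presheaf_cat C) (G, \<theta>, H) (F, \<eta>, G')
    = (F, (\<lambda>X\<in>Obj C. Compose set_cat (\<theta> X) (\<eta> X)), H)"
  by (simp_all add: presheaf_cat_def functor_cat_def op_cat_def)

text \<open>
  The composites of arrows need not be arrows here: only sources and targets are controlled.
  Nothing more is needed for limits of presheaves, so that it does not matter whether
  (pre)stratified maps compose.
\<close>

locale graph_map =
  fixes B :: "('p, 'q) cat" and C :: "('o, 'm) cat" and G :: "('p, 'q, 'o, 'm) func"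
  assumes Dom_in: "f \<in> Arr B \<Longrightarrow> Dom B f \<in> Obj B"
    and Cod_in: "f \<in> Arr B \<Longrightarrow> Cod B f \<in> Obj B"
    and OMap_in: "X \<in> Obj B \<Longrightarrow> OMap G X \<in> Obj C"
    and AMap_in: "f \<in> Arr B \<Longrightarrow> AMap G f \<in> Arr C"
    and Dom_AMap: "f \<in> Arr B \<Longrightarrow> Dom C (AMap G f) = OMap G (Dom B f)"
    and Cod_AMap: "f \<in> Arr B \<Longrightarrow> Cod C (AMap G f) = OMap G (Cod B f)"
    and Dom_AMap_Ident: "X \<in> Obj B \<Longrightarrow> Dom C (AMap G (Ident B X)) = OMap G X"
    and Cod_AMap_Ident: "X \<in> Obj B \<Longrightarrow> Cod C (AMap G (Ident B X)) = OMap G X"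
    and Dom_AMap_Compose: "\<lbrakk>f \<in> Arr B; g \<in> Arr B; Cod B f = Dom B g\<rbrakk>
      \<Longrightarrow> Dom C (AMap G (Compose B g f)) = OMap G (Dom B f)"
    and Cod_AMap_Compose: "\<lbrakk>f \<in> Arr B; g \<in> Arr B; Cod B f = Dom B g\<rbrakk>
      \<Longrightarrow> Cod C (AMap G (Compose B g f)) = OMap G (Cod B g)"
    and Dom_Compose: "\<lbrakk>f \<in> Arr B; g \<in> Arr B; Cod B f = Dom B g\<rbrakk>
      \<Longrightarrow> Dom B (Compose B g f) = Dom B f"

abbreviation id_func :: "('o, 'm, 'o, 'm) func" where
  "id_func \<equiv> \<lparr>OMap = id, AMap = id\<rparr>"

lemma comp_func_id: "comp_func F id_func = F"
  by (simp add: comp_func_def)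

locale presheaf_diagram = graph_map C C id_func + J: category J
  for C :: "('o, 'm) cat" and J :: "('u, 'u) cat" +
  fixes D :: "('u, 'u, ('o, 'm, 'u) presheaf,
      ('o, 'm, 'u) presheaf \<times> ('o \<Rightarrow> 'u fn) \<times> ('o, 'm, 'u) presheaf) func"
  assumes univ: "universe TYPE('u)"
    and small_J: "small TYPE('u) (Obj J)"
    and D: "is_functor J (presheaf_cat C) D"
begin

definition trans :: "'u \<Rightarrow> 'o \<Rightarrow> 'u fn" where
  "trans a = fst (snd (AMap D a))"

definition fam :: "'o \<Rightarrow> ('u \<Rightarrow> 'u) set" where
  "fam X = {s \<in> (\<Pi>\<^sub>E j\<in>Obj J. OMap (OMap D j) X).
     \<forall>a\<in>Arr J. fn_app (trans a X) (s (Dom J a)) = s (Cod J a)}"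

text \<open>A small set is a subset of \<open>'u\<close>, so compatible families have to be encoded by elements of \<open>'u\<close>.\<close>

definition enc :: "'o \<Rightarrow> ('u \<Rightarrow> 'u) \<Rightarrow> 'u" where
  "enc X = (SOME e. inj_on e (fam X))"

definition dec :: "'o \<Rightarrow> 'u \<Rightarrow> 'u \<Rightarrow> 'u" where
  "dec X = inv_into (fam X) (enc X)"

definition act :: "'m \<Rightarrow> ('u \<Rightarrow> 'u) \<Rightarrow> 'u \<Rightarrow> 'u" where
  "act f s = (\<lambda>j\<in>Obj J. fn_app (AMap (OMap D j) f) (s j))"

text \<open>The presheaf \<open>X \<mapsto> fam X\<close> of compatible families, carried over along
  the bijections \<open>enc X\<close>. Contravariance makes \<open>Cod C f\<close> the place where a
  section is decoded and \<open>Dom C f\<close> the place where its restriction is encoded.\<close>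

definition lim :: "('o, 'm, 'u) presheaf" where
  "lim = \<lparr>OMap = (\<lambda>X. enc X ` fam X),
    AMap = (\<lambda>f. (enc (Cod C f) ` fam (Cod C f),
      \<lambda>y\<in>enc (Cod C f) ` fam (Cod C f). enc (Dom C f) (act f (dec (Cod C f) y)),
      enc (Dom C f) ` fam (Dom C f)))\<rparr>"

definition proj :: "'u \<Rightarrow> ('o, 'm, 'u) presheaf \<times> ('o \<Rightarrow> 'u fn) \<times> ('o, 'm, 'u) presheaf" where
  "proj j = (lim, \<lambda>X\<in>Obj C. (OMap lim X, \<lambda>y\<in>OMap lim X. dec X y j, OMap (OMap D j) X), OMap D j)"

section \<open>The diagram on elements, and coded compatible families\<close>

lemma presheaf_D: "j \<in> Obj J \<Longrightarrow> is_presheaf C (OMap D j)"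
  using D by (auto simp: is_functor_def Obj_presheaf_cat)

lemma AMap_D: "a \<in> Arr J \<Longrightarrow> AMap D a = (OMap D (Dom J a), trans a, OMap D (Cod J a))"
  using D by (cases "AMap D a") (auto simp: is_functor_def trans_def)

lemma trans_Arr:
  "a \<in> Arr J \<Longrightarrow> (OMap D (Dom J a), trans a, OMap D (Cod J a)) \<in> Arr (presheaf_cat C)"
  using D AMap_D by (auto simp: is_functor_def)

lemma trans_hom:
  "a \<in> Arr J \<Longrightarrow> X \<in> Obj C \<Longrightarrow>
     trans a X \<in> set_hom (OMap (OMap D (Dom J a)) X) (OMap (OMap D (Cod J a)) X)"
  using trans_Arr by (auto simp: Arr_presheaf_cat)

lemma D_hom:
  "j \<in> Obj J \<Longrightarrow> f \<in> Arr C \<Longrightarrow>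
     AMap (OMap D j) f \<in> set_hom (OMap (OMap D j) (Cod C f)) (OMap (OMap D j) (Dom C f))"
  using presheaf_D by (auto simp: is_presheaf_iff)

text \<open>Naturality read on elements. It makes restriction preserve compatible families and,
  later, makes glued sections compatible.\<close>

lemma trans_natural:
  assumes a: "a \<in> Arr J" and f: "f \<in> Arr C" and x: "x \<in> OMap (OMap D (Dom J a)) (Cod C f)"
  shows "fn_app (trans a (Dom C f)) (fn_app (AMap (OMap D (Dom J a)) f) x)
    = fn_app (AMap (OMap D (Cod J a)) f) (fn_app (trans a (Cod C f)) x)"
proof -
  have "Compose set_cat (trans a (Dom C f)) (AMap (OMap D (Dom J a)) f)
      = Compose set_cat (AMap (OMap D (Cod J a)) f) (trans a (Cod C f))"
    using trans_Arr[OF a] f by (auto simp: Arr_presheaf_cat)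
  then show ?thesis
    using fn_app_Compose[OF D_hom[OF J.Dom_Obj[OF a] f] x]
      fn_app_Compose[OF trans_hom[OF a Cod_in[OF f]] x] by metis
qed

lemma small_fam:
  assumes "X \<in> Obj C"
  shows "small TYPE('u) (fam X)"
proof (rule small_lepoll)
  show "small TYPE('u) (\<Pi>\<^sub>E j\<in>Obj J. OMap (OMap D j) X)"
    using presheaf_D assms by (intro small_PiE univ small_J) (auto simp: is_presheaf_iff)
qed (auto simp: fam_def intro: subset_imp_lepoll)

text \<open>Smallness of the product is spent here: a small set injects into \<open>'u\<close>, so
  the choice in \<open>enc\<close> picks an actual injection.\<close>

lemma inj_enc:
  assumes "X \<in> Obj C"
  shows "inj_on (enc X) (fam X)"
proof -
  have "fam X \<lesssim> (UNIV :: 'u set)"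
    using small_fam[OF assms] by (simp add: small_def lesspoll_def)
  then obtain e :: "('u \<Rightarrow> 'u) \<Rightarrow> 'u" where "inj_on e (fam X)"
    by (auto simp: lepoll_def)
  then show ?thesis
    unfolding enc_def by (rule someI[where P = "\<lambda>e. inj_on e (fam X)"])
qed

lemma dec_enc [simp]: "X \<in> Obj C \<Longrightarrow> s \<in> fam X \<Longrightarrow> dec X (enc X s) = s"
  by (simp add: dec_def inj_enc)

lemma enc_dec [simp]: "y \<in> OMap lim X \<Longrightarrow> enc X (dec X y) = y"
  by (auto simp: dec_def lim_def f_inv_into_f)

lemma dec_fam: "y \<in> OMap lim X \<Longrightarrow> dec X y \<in> fam X"
  by (auto simp: dec_def lim_def intro: inv_into_into)

lemma enc_lim: "s \<in> fam X \<Longrightarrow> enc X s \<in> OMap lim X"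
  by (simp add: lim_def)

text \<open>Families are extensional on \<open>Obj J\<close> and \<open>enc X\<close> undoes
  \<open>dec X\<close> on the limit, so the projections are jointly injective. This is the source of
  uniqueness for mediating maps and for glued sections.\<close>

lemma lim_eqI:
  assumes "y \<in> OMap lim X" "y' \<in> OMap lim X" "\<And>j. j \<in> Obj J \<Longrightarrow> dec X y j = dec X y' j"
  shows "y = y'"
proof -
  have "dec X y = dec X y'"
    using dec_fam[OF assms(1)] dec_fam[OF assms(2)] assms(3)
    by (intro PiE_ext[of _ "Obj J" "\<lambda>j. OMap (OMap D j) X"]) (simp_all add: fam_def)
  then show ?thesis
    using assms enc_dec by metis
qed

lemma fam_comp: "s \<in> fam X \<Longrightarrow> j \<in> Obj J \<Longrightarrow> s j \<in> OMap (OMap D j) X"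
  by (auto simp: fam_def)

lemma fam_trans: "s \<in> fam X \<Longrightarrow> a \<in> Arr J \<Longrightarrow> fn_app (trans a X) (s (Dom J a)) = s (Cod J a)"
  by (auto simp: fam_def)

section \<open>Restriction maps and functoriality of the pointwise limit\<close>

lemma act_fam:
  assumes "f \<in> Arr C" "s \<in> fam (Cod C f)"
  shows "act f s \<in> fam (Dom C f)"
proof -
  have "fn_app (AMap (OMap D j) f) (s j) \<in> OMap (OMap D j) (Dom C f)" if "j \<in> Obj J" for j
    using set_hom_app[OF D_hom[OF that assms(1)] fam_comp[OF assms(2) that]] .
  moreover have "fn_app (trans a (Dom C f)) (fn_app (AMap (OMap D (Dom J a)) f) (s (Dom J a)))
      = fn_app (AMap (OMap D (Cod J a)) f) (s (Cod J a))" if a: "a \<in> Arr J" for a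
    using trans_natural[OF a assms(1) fam_comp[OF assms(2) J.Dom_Obj[OF a]]]
      fam_trans[OF assms(2) a] by simp
  ultimately show ?thesis
    by (simp add: fam_def act_def J.Dom_Obj J.Cod_Obj)
qed

lemma small_lim: "X \<in> Obj C \<Longrightarrow> small TYPE('u) (OMap lim X)"
  unfolding lim_def by (simp add: small_lepoll[OF small_fam image_lepoll])

lemma AMap_lim:
  "AMap lim f = (OMap lim (Cod C f),
      \<lambda>y\<in>OMap lim (Cod C f). enc (Dom C f) (act f (dec (Cod C f) y)), OMap lim (Dom C f))"
  by (simp add: lim_def)

lemma AMap_lim_hom: "f \<in> Arr C \<Longrightarrow> AMap lim f \<in> set_hom (OMap lim (Cod C f)) (OMap lim (Dom C f))"
  unfolding AMap_lim by (intro set_homI small_lim enc_lim act_fam dec_fam)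
    (use Dom_in Cod_in in auto)

lemma dec_AMap_lim:
  assumes "f \<in> Arr C" "y \<in> OMap lim (Cod C f)" "j \<in> Obj J"
  shows "dec (Dom C f) (fn_app (AMap lim f) y) j
    = fn_app (AMap (OMap D j) f) (dec (Cod C f) y j)"
  using assms by (simp add: AMap_lim Dom_in act_fam dec_fam) (simp add: act_def)

text \<open>Families are restricted componentwise, so both functor laws reduce to those of the
  presheaves in \<open>DG\<close>. Nothing is assumed about \<open>G\<close> preserving identities
  or composites.\<close>

lemma presheaf_comp_lim:
  assumes "graph_map B C G"
    and DG: "\<And>j. j \<in> Obj J \<Longrightarrow> is_presheaf B (comp_func (OMap D j) G)"
  shows "is_presheaf B (comp_func lim G)"
proof -
  interpret G: graph_map B C G by fact
  note DG' = DG[unfolded is_presheaf_iff comp_func_def, simplified]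
  have ident: "AMap lim (AMap G (Ident B X)) = Ident set_cat (OMap lim (OMap G X))"
    if X: "X \<in> Obj B" for X
  proof -
    have "act (AMap G (Ident B X)) s = s" if s: "s \<in> fam (OMap G X)" for s
    proof (rule extensionalityI[of _ "Obj J"])
      show "s \<in> extensional (Obj J)"
        using s by (auto simp: fam_def PiE_def)
      fix j assume j: "j \<in> Obj J"
      then have "AMap (OMap D j) (AMap G (Ident B X)) = Ident set_cat (OMap (OMap D j) (OMap G X))"
        using DG' X by blast
      then show "act (AMap G (Ident B X)) s j = s j"
        using j fam_comp[OF s j] by (simp add: act_def fn_app_Ident)
    qed (simp add: act_def)
    then show ?thesis
      using X dec_fam by (auto simp: AMap_lim G.Dom_AMap_Ident G.Cod_AMap_Ident set_cat_def)
  qed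
  have compose: "AMap lim (AMap G (Compose B g f))
      = Compose set_cat (AMap lim (AMap G f)) (AMap lim (AMap G g))"
    if f: "f \<in> Arr B" and g: "g \<in> Arr B" and fg: "Cod B f = Dom B g" for f g
  proof -
    have "act (AMap G (Compose B g f)) s = act (AMap G f) (act (AMap G g) s)"
      if s: "s \<in> fam (OMap G (Cod B g))" for s
      unfolding act_def
    proof (rule restrict_ext)
      fix j assume j: "j \<in> Obj J"
      have "AMap (OMap D j) (AMap G (Compose B g f))
          = Compose set_cat (AMap (OMap D j) (AMap G f)) (AMap (OMap D j) (AMap G g))"
        using DG'[OF j] f g fg by blast
      moreover have "AMap (OMap D j) (AMap G g)
          \<in> set_hom (OMap (OMap D j) (OMap G (Cod B g))) (OMap (OMap D j) (OMap G (Dom B g)))"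
        using DG'[OF j] g by blast
      ultimately show "fn_app (AMap (OMap D j) (AMap G (Compose B g f))) (s j)
          = fn_app (AMap (OMap D j) (AMap G f))
             ((\<lambda>j\<in>Obj J. fn_app (AMap (OMap D j) (AMap G g)) (s j)) j)"
        using j fn_app_Compose fam_comp[OF s j] by simp
    qed
    \<comment> \<open>Membership in \<open>fam\<close> is what lets \<open>dec\<close> cancel
      \<open>enc\<close> between the two successive restriction maps.\<close>
    moreover have "act (AMap G g) s \<in> fam (OMap G (Dom B g))"
      if "s \<in> fam (OMap G (Cod B g))" for s
      using act_fam[OF G.AMap_in[OF g]] that g by (simp add: G.Dom_AMap G.Cod_AMap)
    ultimately have "enc (OMap G (Dom B f)) (act (AMap G (Compose B g f)) (dec (OMap G (Cod B g)) y))
        = fn_app (AMap lim (AMap G f)) (fn_app (AMap lim (AMap G g)) y)"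
      if "y \<in> OMap lim (OMap G (Cod B g))" for y
      using dec_fam[OF that] that enc_lim G.OMap_in[OF G.Dom_in[OF g]]
      by (simp add: AMap_lim G.Dom_AMap[OF f] G.Dom_AMap[OF g] G.Cod_AMap[OF f] G.Cod_AMap[OF g] fg)
    then show ?thesis
      by (auto simp: AMap_lim[of "AMap G (Compose B g f)"] G.Dom_AMap_Compose[OF f g fg]
          G.Cod_AMap_Compose[OF f g fg] G.Dom_AMap[OF f] G.Cod_AMap[OF g]
          AMap_lim[of "AMap G f"] AMap_lim[of "AMap G g"] set_cat_def compose_def
          intro!: restrict_ext)
  qed
  show ?thesis
    unfolding is_presheaf_iff comp_func_def
    using ident compose AMap_lim_hom[OF G.AMap_in] G.Dom_AMap G.Cod_AMap
    by (auto simp: small_lim G.OMap_in)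
qed

lemma presheaf_lim: "is_presheaf C lim"
  using presheaf_comp_lim[OF graph_map_axioms] presheaf_D by (simp add: comp_func_id)

section \<open>Projections, limit cone and universal property\<close>

lemma proj_hom:
  assumes "X \<in> Obj C" "j \<in> Obj J"
  shows "(OMap lim X, \<lambda>y\<in>OMap lim X. dec X y j, OMap (OMap D j) X)
    \<in> set_hom (OMap lim X) (OMap (OMap D j) X)"
  using assms presheaf_D[OF assms(2)]
  by (intro set_homI small_lim fam_comp[OF dec_fam]) (auto simp: is_presheaf_iff)

lemma proj_Arr:
  assumes j: "j \<in> Obj J"
  shows "proj j \<in> Arr (presheaf_cat C)"
proof -
  define p where "p = (\<lambda>X\<in>Obj C. (OMap lim X, \<lambda>y\<in>OMap lim X. dec X y j, OMap (OMap D j) X))"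
  have p: "p X \<in> set_hom (OMap lim X) (OMap (OMap D j) X)" if "X \<in> Obj C" for X
    using proj_hom[OF that j] that by (simp add: p_def)
  have p_app: "fn_app (p X) y = dec X y j" if "X \<in> Obj C" "y \<in> OMap lim X" for X y
    using that by (simp add: p_def)
  have natural: "Compose set_cat (p (Dom C f)) (AMap lim f)
      = Compose set_cat (AMap (OMap D j) f) (p (Cod C f))" if f: "f \<in> Arr C" for f
  proof (rule set_hom_eqI)
    note X = Dom_in[OF f] and Y = Cod_in[OF f]
    show "Compose set_cat (p (Dom C f)) (AMap lim f)
        \<in> set_hom (OMap lim (Cod C f)) (OMap (OMap D j) (Dom C f))"
      by (rule set_hom_Compose[OF AMap_lim_hom[OF f] p[OF X]])
    show "Compose set_cat (AMap (OMap D j) f) (p (Cod C f))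
        \<in> set_hom (OMap lim (Cod C f)) (OMap (OMap D j) (Dom C f))"
      by (rule set_hom_Compose[OF p[OF Y] D_hom[OF j f]])
    fix y assume y: "y \<in> OMap lim (Cod C f)"
    show "fn_app (Compose set_cat (p (Dom C f)) (AMap lim f)) y
        = fn_app (Compose set_cat (AMap (OMap D j) f) (p (Cod C f))) y"
      unfolding fn_app_Compose[OF AMap_lim_hom[OF f] y] fn_app_Compose[OF p[OF Y] y]
        p_app[OF Y y] p_app[OF X set_hom_app[OF AMap_lim_hom[OF f] y]]
      by (rule dec_AMap_lim[OF f y j])
  qed
  have "p \<in> extensional (Obj C)"
    by (simp add: p_def)
  then have "(lim, p, OMap D j) \<in> Arr (presheaf_cat C)"
    using natural p presheaf_lim presheaf_D[OF j] by (simp add: Arr_presheaf_cat)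
  then show ?thesis
    by (simp add: proj_def p_def)
qed

text \<open>Evaluated at a coded family, the cone equation is exactly the compatibility condition in
  \<open>fam\<close>.\<close>

lemma cone_lim: "is_cone J (presheaf_cat C) D lim proj"
  unfolding is_cone_def
proof (intro conjI ballI)
  fix a assume a: "a \<in> Arr J"
  have "Compose set_cat (trans a X) (OMap lim X, \<lambda>y\<in>OMap lim X. dec X y (Dom J a),
        OMap (OMap D (Dom J a)) X)
      = (OMap lim X, \<lambda>y\<in>OMap lim X. dec X y (Cod J a), OMap (OMap D (Cod J a)) X)"
    if X: "X \<in> Obj C" for X
  proof (rule set_hom_eqI)
    fix y assume y: "y \<in> OMap lim X"
    then show "fn_app (Compose set_cat (trans a X) (OMap lim X, \<lambda>y\<in>OMap lim X. dec X y (Dom J a),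
        OMap (OMap D (Dom J a)) X)) y
      = fn_app (OMap lim X, \<lambda>y\<in>OMap lim X. dec X y (Cod J a), OMap (OMap D (Cod J a)) X) y"
      using fn_app_Compose[OF proj_hom[OF X J.Dom_Obj[OF a]] y] fam_trans[OF dec_fam[OF y] a]
      by simp
  qed (rule set_hom_Compose proj_hom trans_hom X a J.Dom_Obj J.Cod_Obj)+
  then show "Compose (presheaf_cat C) (AMap D a) (proj (Dom J a)) = proj (Cod J a)"
    unfolding AMap_D[OF a] proj_def by (auto intro!: restrict_ext)
qed (use proj_Arr presheaf_lim in \<open>auto simp: Obj_presheaf_cat proj_def\<close>)

lemma is_limit_lim: "is_limit J (presheaf_cat C) D lim proj"
  unfolding is_limit_def
proof (intro conjI allI impI cone_lim)
  fix Y \<rho> assume cone: "is_cone J (presheaf_cat C) D Y \<rho>"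
  have Y: "is_presheaf C Y"
    using cone by (simp add: is_cone_def Obj_presheaf_cat)
  define r where "r j = fst (snd (\<rho> j))" for j
  have \<rho>: "\<rho> j = (Y, r j, OMap D j)" if "j \<in> Obj J" for j
    using cone that unfolding is_cone_def r_def by (cases "\<rho> j") auto
  have r_Arr: "(Y, r j, OMap D j) \<in> Arr (presheaf_cat C)" if "j \<in> Obj J" for j
    using cone that \<rho>[OF that] unfolding is_cone_def by metis
  have r: "r j X \<in> set_hom (OMap Y X) (OMap (OMap D j) X)" if "j \<in> Obj J" "X \<in> Obj C" for j X
    using r_Arr that by (auto simp: Arr_presheaf_cat)
  have Y_hom: "AMap Y f \<in> set_hom (OMap Y (Cod C f)) (OMap Y (Dom C f))" if "f \<in> Arr C" for f
    using Y that by (auto simp: is_presheaf_iff)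
  \<comment> \<open>The images of \<open>y\<close> under all legs of the cone; the cone equations
    make them a compatible family, and its code is the value of the mediating map \<open>c\<close>
    at \<open>y\<close>.\<close>
  define w where "w X y = (\<lambda>j\<in>Obj J. fn_app (r j X) y)" for X y
  have w: "w X y \<in> fam X" if X: "X \<in> Obj C" and y: "y \<in> OMap Y X" for X y
  proof -
    have "fn_app (trans a X) (fn_app (r (Dom J a) X) y) = fn_app (r (Cod J a) X) y"
      if a: "a \<in> Arr J" for a
    proof -
      have "Compose (presheaf_cat C) (AMap D a) (\<rho> (Dom J a)) = \<rho> (Cod J a)"
        using cone a by (auto simp: is_cone_def)
      then have "(\<lambda>X\<in>Obj C. Compose set_cat (trans a X) (r (Dom J a) X)) = r (Cod J a)"
        by (simp add: AMap_D[OF a] \<rho> J.Dom_Obj[OF a] J.Cod_Obj[OF a])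
      then have "Compose set_cat (trans a X) (r (Dom J a) X) = r (Cod J a) X"
        using restrict_apply'[OF X, of "\<lambda>X. Compose set_cat (trans a X) (r (Dom J a) X)"] by simp
      then show ?thesis
        using fn_app_Compose[OF r[OF J.Dom_Obj[OF a] X] y] by metis
    qed
    then show ?thesis
      using set_hom_app[OF r[OF _ X] y] by (auto simp: fam_def w_def J.Dom_Obj J.Cod_Obj)
  qed
  define c where "c = (\<lambda>X\<in>Obj C. (OMap Y X, \<lambda>y\<in>OMap Y X. enc X (w X y), OMap lim X))"
  have c_hom: "c X \<in> set_hom (OMap Y X) (OMap lim X)" if "X \<in> Obj C" for X
    unfolding c_def restrict_apply'[OF that]
    using Y that by (intro set_homI small_lim enc_lim w) (auto simp: is_presheaf_iff)
  have dec_c: "dec X (fn_app (c X) y) j = fn_app (r j X) y"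
    if "X \<in> Obj C" "y \<in> OMap Y X" "j \<in> Obj J" for X y j
    using that w by (simp add: c_def) (simp add: w_def)
  have c_Arr: "(Y, c, lim) \<in> Arr (presheaf_cat C)"
    unfolding Arr_presheaf_cat
  proof (intro conjI ballI Y presheaf_lim c_hom)
    fix f assume f: "f \<in> Arr C"
    note X = Dom_in[OF f] and Z = Cod_in[OF f]
    show "Compose set_cat (c (Dom C f)) (AMap Y f) = Compose set_cat (AMap lim f) (c (Cod C f))"
    proof (rule set_hom_eqI)
      fix y assume y: "y \<in> OMap Y (Cod C f)"
      have fy: "fn_app (AMap Y f) y \<in> OMap Y (Dom C f)"
        and cy: "fn_app (c (Cod C f)) y \<in> OMap lim (Cod C f)"
        using set_hom_app[OF Y_hom[OF f] y] set_hom_app[OF c_hom[OF Z] y] by auto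
      show "fn_app (Compose set_cat (c (Dom C f)) (AMap Y f)) y
          = fn_app (Compose set_cat (AMap lim f) (c (Cod C f))) y"
        unfolding fn_app_Compose[OF Y_hom[OF f] y] fn_app_Compose[OF c_hom[OF Z] y]
      \<comment> \<open>After projecting to \<open>j\<close>, naturality of \<open>c\<close> becomes
        naturality of the leg \<open>r j\<close>.\<close>
      proof (rule lim_eqI)
        fix j assume j: "j \<in> Obj J"
        have "Compose set_cat (r j (Dom C f)) (AMap Y f)
            = Compose set_cat (AMap (OMap D j) f) (r j (Cod C f))"
          using r_Arr[OF j] f by (auto simp: Arr_presheaf_cat)
        then have "fn_app (r j (Dom C f)) (fn_app (AMap Y f) y)
            = fn_app (AMap (OMap D j) f) (fn_app (r j (Cod C f)) y)"
          using fn_app_Compose[OF Y_hom[OF f] y] fn_app_Compose[OF r[OF j Z] y] by metis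
        then show "dec (Dom C f) (fn_app (c (Dom C f)) (fn_app (AMap Y f) y)) j
            = dec (Dom C f) (fn_app (AMap lim f) (fn_app (c (Cod C f)) y)) j"
          using dec_c[OF X fy j] dec_c[OF Z y j] dec_AMap_lim[OF f cy j] by simp
      qed (use set_hom_app[OF c_hom[OF X] fy] set_hom_app[OF AMap_lim_hom[OF f] cy] in auto)
    qed (rule set_hom_Compose Y_hom c_hom AMap_lim_hom X Z f)+
  qed (simp add: c_def)
  \<comment> \<open>Keeping \<open>e\<close> arbitrary serves both halves of the universal property:
    \<open>e = c\<close> gives existence, and a competing \<open>e\<close> is forced to have the
    same components as \<open>c\<close>.\<close>
  have proj_iff: "Compose (presheaf_cat C) (proj j) (Y, e, lim) = \<rho> j \<longleftrightarrow>
      (\<forall>X\<in>Obj C. \<forall>y\<in>OMap Y X. dec X (fn_app (e X) y) j = fn_app (r j X) y)"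
    if e: "\<And>X. X \<in> Obj C \<Longrightarrow> e X \<in> set_hom (OMap Y X) (OMap lim X)" and j: "j \<in> Obj J" for e j
  proof -
    have pX: "Compose set_cat (OMap lim X, \<lambda>y\<in>OMap lim X. dec X y j, OMap (OMap D j) X) (e X) = r j X
        \<longleftrightarrow> (\<forall>y\<in>OMap Y X. dec X (fn_app (e X) y) j = fn_app (r j X) y)" (is "?c = _ \<longleftrightarrow> ?R")
      if X: "X \<in> Obj C" for X
    proof -
      have c: "?c \<in> set_hom (OMap Y X) (OMap (OMap D j) X)"
        by (rule set_hom_Compose[OF e[OF X] proj_hom[OF X j]])
      have "fn_app ?c y = dec X (fn_app (e X) y) j" if "y \<in> OMap Y X" for y
        using fn_app_Compose[OF e[OF X] that] set_hom_app[OF e[OF X] that] by simp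
      then show ?thesis
        using set_hom_eqI[OF c r[OF j X]] by metis
    qed
    have "r j \<in> extensional (Obj C)"
      using r_Arr[OF j] by (simp add: Arr_presheaf_cat)
    then have "Compose (presheaf_cat C) (proj j) (Y, e, lim) = \<rho> j \<longleftrightarrow>
        (\<forall>X\<in>Obj C. Compose set_cat (OMap lim X, \<lambda>y\<in>OMap lim X. dec X y j, OMap (OMap D j) X) (e X)
          = r j X)"
      unfolding \<rho>[OF j] proj_def
      by (auto simp: fun_eq_iff extensional_def restrict_def)
    then show ?thesis
      using pX by simp
  qed
  show "\<exists>!u. u \<in> Arr (presheaf_cat C) \<and> Dom (presheaf_cat C) u = Y \<and>
      Cod (presheaf_cat C) u = lim \<and> (\<forall>j\<in>Obj J. Compose (presheaf_cat C) (proj j) u = \<rho> j)"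
  proof (rule ex1I[of _ "(Y, c, lim)"])
    show "(Y, c, lim) \<in> Arr (presheaf_cat C) \<and> Dom (presheaf_cat C) (Y, c, lim) = Y \<and>
        Cod (presheaf_cat C) (Y, c, lim) = lim \<and>
        (\<forall>j\<in>Obj J. Compose (presheaf_cat C) (proj j) (Y, c, lim) = \<rho> j)"
      using c_Arr proj_iff[OF c_hom] dec_c by simp
  next
    fix u assume u: "u \<in> Arr (presheaf_cat C) \<and> Dom (presheaf_cat C) u = Y \<and>
      Cod (presheaf_cat C) u = lim \<and> (\<forall>j\<in>Obj J. Compose (presheaf_cat C) (proj j) u = \<rho> j)"
    then obtain e where e: "u = (Y, e, lim)"
      by (cases u) auto
    have e_hom: "e X \<in> set_hom (OMap Y X) (OMap lim X)" if "X \<in> Obj C" for X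
      using u e that by (auto simp: Arr_presheaf_cat)
    have "e = c"
    proof (rule extensionalityI[of _ "Obj C"])
      fix X assume X: "X \<in> Obj C"
      show "e X = c X"
      proof (rule set_hom_eqI[OF e_hom[OF X] c_hom[OF X]])
        fix y assume y: "y \<in> OMap Y X"
        show "fn_app (e X) y = fn_app (c X) y"
        proof (rule lim_eqI)
          fix j assume j: "j \<in> Obj J"
          have "dec X (fn_app (e X) y) j = fn_app (r j X) y"
            using u j X y proj_iff[OF e_hom j] by (simp add: e)
          then show "dec X (fn_app (e X) y) j = dec X (fn_app (c X) y) j"
            by (simp add: dec_c[OF X y j])
        qed (rule set_hom_app[OF e_hom[OF X] y] set_hom_app[OF c_hom[OF X] y])+
      qed
    qed (use u c_Arr in \<open>auto simp: e Arr_presheaf_cat\<close>)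
    then show "u = (Y, c, lim)"
      by (simp add: e)
  qed
qed

section \<open>Gluing in the pointwise limit\<close>

lemma sheaf_comp_lim:
  assumes "graph_map B C G"
    and DG: "\<And>j. j \<in> Obj J \<Longrightarrow> is_sheaf B cov (comp_func (OMap D j) G)"
  shows "is_sheaf B cov (comp_func lim G)"
proof -
  interpret G: graph_map B C G by fact
  have "\<exists>!y. y \<in> OMap lim (OMap G X) \<and> (\<forall>f\<in>R. fn_app (AMap lim (AMap G f)) y = x f)"
    if X: "X \<in> Obj B" and sieve: "is_sieve B X R" and cov: "cov X R"
      and match: "is_matching B (comp_func lim G) R x" for X R x
  proof -
    note GX = G.OMap_in[OF X]
    have R: "f \<in> Arr B" "Cod B f = X" if "f \<in> R" for f
      using sieve that by (auto simp: is_sieve_def)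
    have GR: "AMap G f \<in> Arr C" "Cod C (AMap G f) = OMap G X"
      "Dom C (AMap G f) = OMap G (Dom B f)" if "f \<in> R" for f
      using R[OF that] G.AMap_in G.Cod_AMap G.Dom_AMap by auto
    have x: "x f \<in> OMap lim (OMap G (Dom B f))" if "f \<in> R" for f
      using match that by (auto simp: is_matching_def comp_func_def)
    define z where "z j f = dec (OMap G (Dom B f)) (x f) j" for j f
    have z: "z j f \<in> OMap (OMap D j) (OMap G (Dom B f))" if "j \<in> Obj J" "f \<in> R" for j f
      using fam_comp[OF dec_fam[OF x]] that by (simp add: z_def)
    have "is_matching B (comp_func (OMap D j) G) R (z j)" if j: "j \<in> Obj J" for j
      unfolding is_matching_def comp_func_def
    proof (simp, intro conjI ballI impI)
      fix f g assume f: "f \<in> R" and g: "g \<in> Arr B" and gf: "Cod B g = Dom B f"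
      have "fn_app (AMap lim (AMap G g)) (x f) = x (Compose B f g)"
        using match f g gf by (auto simp: is_matching_def comp_func_def)
      \<comment> \<open>The right side decodes over \<open>Dom B (Compose B f g)\<close>, which has
        to be identified with \<open>Dom B g\<close>; this is the purpose of the axiom
        \<open>Dom_Compose\<close> of \<open>graph_map\<close>.\<close>
      then show "fn_app (AMap (OMap D j) (AMap G g)) (z j f) = z j (Compose B f g)"
        using dec_AMap_lim[OF G.AMap_in[OF g] _ j, of "x f"] x[OF f] g gf R[OF f]
        by (simp add: z_def G.Dom_AMap G.Cod_AMap G.Dom_Compose)
    qed (rule z[OF j])
    then have glue: "\<exists>!y. y \<in> OMap (OMap D j) (OMap G X) \<and>
        (\<forall>f\<in>R. fn_app (AMap (OMap D j) (AMap G f)) y = z j f)" if "j \<in> Obj J" for j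
      using DG[OF that, unfolded is_sheaf_def, THEN conjunct2, rule_format, OF X] sieve cov that
      by (simp add: comp_func_def)
    \<comment> \<open>\<open>glue\<close> makes the description well defined; restricting to
      \<open>Obj J\<close> gives the extensionality that \<open>fam\<close> demands.\<close>
    define s where "s = (\<lambda>j\<in>Obj J. THE y. y \<in> OMap (OMap D j) (OMap G X) \<and>
        (\<forall>f\<in>R. fn_app (AMap (OMap D j) (AMap G f)) y = z j f))"
    have s: "s j \<in> OMap (OMap D j) (OMap G X)"
      "f \<in> R \<Longrightarrow> fn_app (AMap (OMap D j) (AMap G f)) (s j) = z j f" if "j \<in> Obj J" for j f
      using theI'[OF glue[OF that]] that by (auto simp: s_def)
    \<comment> \<open>Both sides restrict to \<open>z (Cod J a) f\<close> along every
      \<open>f\<close> in \<open>R\<close>: naturality moves \<open>trans a\<close> past the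
      restriction, and each \<open>x f\<close> decodes to a compatible family. Uniqueness of gluing
      over \<open>Cod J a\<close> concludes.\<close>
    have "fn_app (trans a (OMap G X)) (s (Dom J a)) = s (Cod J a)" if a: "a \<in> Arr J" for a
    proof -
      note d = J.Dom_Obj[OF a] and c = J.Cod_Obj[OF a]
      have "fn_app (AMap (OMap D (Cod J a)) (AMap G f))
          (fn_app (trans a (OMap G X)) (s (Dom J a))) = z (Cod J a) f" if f: "f \<in> R" for f
        using trans_natural[OF a GR(1)[OF f], of "s (Dom J a)"] s[OF d] f
          fam_trans[OF dec_fam[OF x[OF f]] a]
        by (simp add: GR(2,3) z_def)
      then show ?thesis
        using glue[OF c] s[OF c] set_hom_app[OF trans_hom[OF a GX] s(1)[OF d]] by blast
    qed
    then have s_fam: "s \<in> fam (OMap G X)"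
      using s(1) by (auto simp: fam_def s_def)
    \<comment> \<open>Being an amalgamation is tested projection by projection, which reduces
      existence and uniqueness in the limit to the componentwise statement
      \<open>glue\<close>.\<close>
    have iff: "fn_app (AMap lim (AMap G f)) y = x f \<longleftrightarrow>
        (\<forall>j\<in>Obj J. fn_app (AMap (OMap D j) (AMap G f)) (dec (OMap G X) y j) = z j f)"
      if y: "y \<in> OMap lim (OMap G X)" and f: "f \<in> R" for y f
    proof -
      have "fn_app (AMap lim (AMap G f)) y \<in> OMap lim (OMap G (Dom B f))"
        using set_hom_app[OF AMap_lim_hom[OF GR(1)[OF f]]] y f by (simp add: GR(2,3))
      then have "fn_app (AMap lim (AMap G f)) y = x f \<longleftrightarrow> (\<forall>j\<in>Obj J.
          dec (OMap G (Dom B f)) (fn_app (AMap lim (AMap G f)) y) j = z j f)"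
        using lim_eqI[OF _ x[OF f]] by (auto simp: z_def)
      then show ?thesis
        using dec_AMap_lim[OF GR(1)[OF f]] y f by (simp add: GR(2,3))
    qed
    show ?thesis
    proof (rule ex1I[of _ "enc (OMap G X) s"])
      show "enc (OMap G X) s \<in> OMap lim (OMap G X) \<and>
          (\<forall>f\<in>R. fn_app (AMap lim (AMap G f)) (enc (OMap G X) s) = x f)"
        using enc_lim[OF s_fam] iff s(2) by (simp add: GX s_fam)
    next
      fix y assume y: "y \<in> OMap lim (OMap G X) \<and> (\<forall>f\<in>R. fn_app (AMap lim (AMap G f)) y = x f)"
      show "y = enc (OMap G X) s"
      proof (rule lim_eqI)
        fix j assume j: "j \<in> Obj J"
        have "dec (OMap G X) y j = s j"
          using y iff j glue[OF j] s[OF j] fam_comp[OF dec_fam, of y "OMap G X" j] by metis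
        then show "dec (OMap G X) y j = dec (OMap G X) (enc (OMap G X) s) j"
          by (simp add: GX s_fam)
      qed (use y enc_lim[OF s_fam] in auto)
    qed
  qed
  moreover have "is_presheaf B (comp_func lim G)"
    using assms by (intro presheaf_comp_lim) (auto simp: is_sheaf_def)
  ultimately show ?thesis
    unfolding is_sheaf_def by (simp add: comp_func_def)
qed

end


section \<open>Stratified and prestratified maps\<close>

text \<open>Every stratified space is a subdivision of itself.\<close>

lemma stratified_imp_prestratified:
  "stratified_space \<X> \<Longrightarrow> stratified_map \<X> \<Y> f \<Longrightarrow> prestratified_map \<X> \<Y> f"
  unfolding prestratified_map_def subdivision_def by blast

text \<open>The class of maps enters \<open>homotopy\<close> only through the time slices, so the
  same \<open>h\<close> works after weakening each slice.\<close>

lemma homotopic_maps_prestratified: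
  assumes "stratified_space \<X>" "homotopic_maps stratified_map n \<X> \<Y> f g"
  shows "homotopic_maps prestratified_map n \<X> \<Y> f g"
proof -
  obtain h where f: "stratified_map \<X> \<Y> f" and g: "stratified_map \<X> \<Y> g"
    and h: "homotopy stratified_map n \<X> \<Y> f g h"
    using assms(2) by (auto simp: homotopic_maps_def)
  have "homotopy prestratified_map n \<X> \<Y> f g h"
    using h unfolding homotopy_def
  proof (elim conjE, intro conjI)
    assume "\<forall>t\<in>{0..1}. stratified_map \<X> \<Y> (\<lambda>x\<in>\<Union>\<X>. h (x, t))"
    then show "\<forall>t\<in>{0..1}. prestratified_map \<X> \<Y> (\<lambda>x\<in>\<Union>\<X>. h (x, t))"
      using stratified_imp_prestratified[OF assms(1)] by blast
  qed assumption+
  then show ?thesis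
    unfolding homotopic_maps_def using f g stratified_imp_prestratified[OF assms(1)] by metis
qed

text \<open>A zigzag of stratified homotopies is a zigzag of prestratified ones, by induction on its
  length; equivalent maps have equal classes.\<close>

lemma homotopy_class_prestratified_eq:
  assumes "stratified_space \<X>" "g \<in> homotopy_class stratified_map n \<X> \<Y> f"
  shows "homotopy_class prestratified_map n \<X> \<Y> g = homotopy_class prestratified_map n \<X> \<Y> f"
proof -
  have "equivclp (homotopic_maps stratified_map n \<X> \<Y>) f g"
    using assms(2) by (simp add: homotopy_class_def)
  then have "equivclp (homotopic_maps prestratified_map n \<X> \<Y>) f g"
  proof (induction rule: equivclp_induct)
    case (step y z)
    then show ?case
      using homotopic_maps_prestratified[OF assms(1)]
      by (blast intro: equivclp_into_equivclp)
  qed simp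
  then show ?thesis
    unfolding homotopy_class_def by (blast intro: equivclp_trans equivclp_sym)
qed

lemma Strat_to_Prestrat_Arr:
  assumes "f \<in> Arr (Strat n)"
  shows "AMap (Strat_to_Prestrat n) f \<in> Arr (Prestrat n)"
proof -
  obtain \<X> \<Y> f' where f: "f = (\<X>, homotopy_class stratified_map n \<X> \<Y> f', \<Y>)"
    and XY: "\<X> \<in> Obj (Prestrat n)" "\<Y> \<in> Obj (Prestrat n)" and f': "stratified_map \<X> \<Y> f'"
    using assms by (auto simp: Strat_def Prestrat_def map_cat_def)
  have X: "stratified_space \<X>"
    using XY by (simp add: Prestrat_def map_cat_def)
  \<comment> \<open>The class is inhabited, so the union defining
    \<open>AMap (Strat_to_Prestrat n)\<close> collapses to one prestratified class instead of being
    empty.\<close>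
  have "f' \<in> homotopy_class stratified_map n \<X> \<Y> f'"
    by (simp add: homotopy_class_def)
  then have "(\<Union>g\<in>homotopy_class stratified_map n \<X> \<Y> f'. homotopy_class prestratified_map n \<X> \<Y> g)
      = homotopy_class prestratified_map n \<X> \<Y> f'"
    using homotopy_class_prestratified_eq[OF X] by blast
  then have "AMap (Strat_to_Prestrat n) f = (\<X>, homotopy_class prestratified_map n \<X> \<Y> f', \<Y>)"
    by (simp add: f Strat_to_Prestrat_def)
  then show ?thesis
    using XY stratified_imp_prestratified[OF X f'] by (auto simp: Prestrat_def map_cat_def)
qed

text \<open>Objects agree on both sides, and the endpoint conditions read only the outer entries of
  triples; the substantial obligation is that arrows go to arrows.\<close>

lemma graph_map_Strat_to_Prestrat: "graph_map (Strat n) (Prestrat n) (Strat_to_Prestrat n)"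
proof
  show "AMap (Strat_to_Prestrat n) f \<in> Arr (Prestrat n)" if "f \<in> Arr (Strat n)" for f
    using that by (rule Strat_to_Prestrat_Arr)
qed (auto simp: Strat_def Prestrat_def Strat_to_Prestrat_def map_cat_def split: prod.splits)

lemma graph_map_Prestrat: "graph_map (Prestrat n) (Prestrat n) id_func"
  by unfold_locales (auto simp: Prestrat_def map_cat_def split: prod.splits)

theorem lemma3p2:
  fixes n :: enat
  assumes "universe TYPE('u)"
  shows "complete_category TYPE('u)
    (Whit n :: ('u strat_presheaf,
      'u strat_presheaf \<times> (rinf set set \<Rightarrow> 'u fn) \<times> 'u strat_presheaf) cat)"
  unfolding complete_category_def
proof (intro conjI allI impI)
  show "category (Whit n :: ('u strat_presheaf,
      'u strat_presheaf \<times> (rinf set set \<Rightarrow> 'u fn) \<times> 'u strat_presheaf) cat)"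
    unfolding Whit_def presheaf_cat_def
    by (intro category_full_subcat category_functor_cat category_set_cat)
      (auto simp: op_cat_def Prestrat_def map_cat_def)
next
  fix J :: "('u, 'u) cat" and D :: "('u, 'u, 'u strat_presheaf,
      'u strat_presheaf \<times> (rinf set set \<Rightarrow> 'u fn) \<times> 'u strat_presheaf) func"
  assume JD: "category J \<and> small TYPE('u) (Obj J) \<and> small TYPE('u) (Arr J) \<and>
    is_functor J (Whit n) D"
  then have DW: "is_functor J (full_subcat (presheaf_cat (Prestrat n)) (is_whitney_category n)) D"
    by (simp add: Whit_def)
  \<comment> \<open>Forgetting the sheaf condition turns \<open>D\<close> into a diagram of
    presheaves on \<open>Prestrat n\<close>.\<close>
  interpret presheaf_diagram "Prestrat n" J D
    using JD DW assms graph_map_Prestrat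
    by (intro presheaf_diagram.intro presheaf_diagram_axioms.intro)
      (auto dest: is_functor_full_subcatD)
  have "is_sheaf (Strat n) strat_covering (comp_func (OMap D j) (Strat_to_Prestrat n))"
    if "j \<in> Obj J" for j
    using DW that by (auto simp: is_functor_def full_subcat_def is_whitney_category_def)
  then have "is_whitney_category n lim"
    unfolding is_whitney_category_def
    using presheaf_lim sheaf_comp_lim[OF graph_map_Strat_to_Prestrat] by blast
  then show "\<exists>X \<pi>. is_limit J (Whit n) D X \<pi>"
    unfolding Whit_def using is_limit_full_subcat[OF is_limit_lim DW] by blast
qed

end
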